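(* Let $\mathbf{k}$ be an integral domain with unity having more than two elements. Let $X$ be a quandle of finite type (if $X$ is finite, assume that $|X|$ is not invertible in $\mathbf{k}$) and $p:X\to Y$ a quandle covering. Suppose that $\mathbf{k}[Y]$ has only trivial idempotents. Then the following hold: (1) The set of all idempotents of $\mathbf{k}[X]$ is a quandle with respect to the ring multiplication. (2) The right multiplication by each idempotent of $\mathbf{k}[X]$ is a ring automorphism of $\mathbf{k}[X]$ induced by some trivial idempotent of $\mathbf{k}[X]$; that is, for each idempotent $u$ there is $x\in X$ such that $wu=we_x$ for all $w\in\mathbf{k}[X]$, and $w\mapsto we_x$ is a ring automorphism of $\mathbf{k}[X]$.
   Context: A quandle is a non-empty set $X$ with a binary operation $*$ such that, for each $y\in X$, the map $S_y:X\to X$, $S_y(x)=x*y$, is an automorphism of $(X,* )$ and $S_y(y)=y$. $X$ is of finite type if each $S_x$ ($x\in X$) has finite order. A quandle homomorphism $p:X\to Y$ is a quandle covering if it is surjective and $S_x=S_{x'}$ whenever $p(x)=p(x')$. The quandle ring $\mathbf{k}[X]$ is the free $\mathbf{k}$-module with basis $\{e_x\mid x\in X\}$ with the (in general non-associative) $\mathbf{k}$-bilinear product determined by $e_xe_y=e_{x*y}$. An idempotent of $\mathbf{k}[X]$ is a non-zero $u$ with $u^2=u$; the idempotents $e_x$ ($x\in X$) are called trivial. *)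

theory Defs
  imports Main "HOL-Library.Poly_Mapping"
begin

definition magma_hom ::
  "'a set \<Rightarrow> ('a \<Rightarrow> 'a \<Rightarrow> 'a) \<Rightarrow> 'b set \<Rightarrow> ('b \<Rightarrow> 'b \<Rightarrow> 'b) \<Rightarrow> ('a \<Rightarrow> 'b) \<Rightarrow> bool" where
  "magma_hom X m Y n f \<longleftrightarrow>
     f ` X \<subseteq> Y \<and> (\<forall>x\<in>X. \<forall>x'\<in>X. f (m x x') = n (f x) (f x'))"

definition magma_aut :: "'a set \<Rightarrow> ('a \<Rightarrow> 'a \<Rightarrow> 'a) \<Rightarrow> ('a \<Rightarrow> 'a) \<Rightarrow> bool" where
  "magma_aut X m f \<longleftrightarrow> magma_hom X m X m f \<and> bij_betw f X X"

locale quandle =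
  fixes X :: "'a set" and m :: "'a \<Rightarrow> 'a \<Rightarrow> 'a"
  assumes nonempty: "X \<noteq> {}"
    and right_aut: "y \<in> X \<Longrightarrow> magma_aut X m (\<lambda>x. m x y)"
    and idem: "y \<in> X \<Longrightarrow> m y y = y"

definition finite_type :: "'a set \<Rightarrow> ('a \<Rightarrow> 'a \<Rightarrow> 'a) \<Rightarrow> bool" where
  "finite_type X m \<longleftrightarrow>
     (\<forall>x\<in>X. \<exists>n>0. \<forall>z\<in>X. ((\<lambda>w. m w x) ^^ n) z = z)"

definition quandle_covering ::
  "'a set \<Rightarrow> ('a \<Rightarrow> 'a \<Rightarrow> 'a) \<Rightarrow> 'b set \<Rightarrow> ('b \<Rightarrow> 'b \<Rightarrow> 'b) \<Rightarrow> ('a \<Rightarrow> 'b) \<Rightarrow> bool" where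
  "quandle_covering X m Y n p \<longleftrightarrow>
     quandle X m \<and> quandle Y n \<and> magma_hom X m Y n p \<and> p ` X = Y \<and>
     (\<forall>x\<in>X. \<forall>x'\<in>X. p x = p x' \<longrightarrow> (\<forall>z\<in>X. m z x = m z x'))"

text \<open>
  The free module on \<open>X\<close> consists of the finitely supported functions whose support lies in
  \<open>X\<close>, with the pointwise addition of \<open>Poly_Mapping\<close>; the basis element \<open>e\<^sub>x\<close> is
  \<open>Poly_Mapping.single x 1\<close>. The product is \<open>qmult\<close> below; it is unrelated to the convolution
  product that \<open>Poly_Mapping\<close> provides when the index type is a monoid.
\<close>

definition qring :: "'a set \<Rightarrow> ('a \<Rightarrow>\<^sub>0 'k::comm_ring_1) set" where
  "qring X = {u. Poly_Mapping.keys u \<subseteq> X}"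

definition basis_elt :: "'a \<Rightarrow> ('a \<Rightarrow>\<^sub>0 'k::comm_ring_1)" where
  "basis_elt x = Poly_Mapping.single x 1"

definition qmult ::
  "('a \<Rightarrow> 'a \<Rightarrow> 'a) \<Rightarrow> ('a \<Rightarrow>\<^sub>0 'k::comm_ring_1) \<Rightarrow> ('a \<Rightarrow>\<^sub>0 'k) \<Rightarrow> ('a \<Rightarrow>\<^sub>0 'k)" where
  "qmult m u v =
     (\<Sum>x\<in>Poly_Mapping.keys u. \<Sum>y\<in>Poly_Mapping.keys v.
        Poly_Mapping.single (m x y) (Poly_Mapping.lookup u x * Poly_Mapping.lookup v y))"

lemma qmult_basis_elt:
  "qmult m (basis_elt x) (basis_elt y) = (basis_elt (m x y) :: 'a \<Rightarrow>\<^sub>0 'k::comm_ring_1)"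
  by (cases "(1::'k) = 0") (simp_all add: qmult_def basis_elt_def)

definition idempotents ::
  "'a set \<Rightarrow> ('a \<Rightarrow> 'a \<Rightarrow> 'a) \<Rightarrow> ('a \<Rightarrow>\<^sub>0 'k::comm_ring_1) set" where
  "idempotents X m = {u \<in> qring X. u \<noteq> 0 \<and> qmult m u u = u}"

definition trivial_idempotents :: "'a set \<Rightarrow> ('a \<Rightarrow>\<^sub>0 'k::comm_ring_1) set" where
  "trivial_idempotents X = basis_elt ` X"

text \<open>
  Quandle rings are in general neither associative nor unital, so the ring homomorphisms of
  \<open>HOL-Algebra\<close>, which preserve a unit, do not apply.
\<close>

definition qring_aut ::
  "'a set \<Rightarrow> ('a \<Rightarrow> 'a \<Rightarrow> 'a) \<Rightarrow> (('a \<Rightarrow>\<^sub>0 'k::comm_ring_1) \<Rightarrow> ('a \<Rightarrow>\<^sub>0 'k)) \<Rightarrow> bool" where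
  "qring_aut X m f \<longleftrightarrow>
     bij_betw f (qring X) (qring X) \<and>
     (\<forall>u\<in>qring X. \<forall>v\<in>qring X. f (u + v) = f u + f v) \<and>
     (\<forall>u\<in>qring X. \<forall>v\<in>qring X. f (qmult m u v) = qmult m (f u) (f v))"

end

theory Submission
  imports Defs
begin

text \<open>
  Elements of a fibre of \<open>p\<close> act alike from the right, so right multiplication by \<open>u\<close> depends
  only on the image of \<open>u\<close> in \<open>k[Y]\<close>. For an idempotent \<open>u\<close> this image is non-zero, since
  otherwise \<open>u = u u = 0\<close>; hence it is an idempotent, so it is some \<open>e\<^sub>y\<close>, and \<open>w u = w e\<^sub>x\<close> for
  every \<open>x\<close> over \<open>y\<close>.
\<close>

section \<open>Linear extension of maps between bases\<close>

text \<open>The pushforward of finitely supported functions: coefficients over one fibre of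
  \<open>f\<close> are added up. It is used for the covering, for a section of it, and for the right
  translations of a quandle.\<close>

definition push :: "('a \<Rightarrow> 'b) \<Rightarrow> ('a \<Rightarrow>\<^sub>0 'k) \<Rightarrow> ('b \<Rightarrow>\<^sub>0 'k::comm_monoid_add)" where
  "push f u = (\<Sum>x\<in>Poly_Mapping.keys u. Poly_Mapping.single (f x) (Poly_Mapping.lookup u x))"

text \<open>Points outside the support contribute zero. A common finite index set makes sums for
  different elements comparable, since \<open>keys (u + v)\<close> may be smaller than the union of
  the two supports.\<close>

lemma push_superset:
  assumes "finite A" "Poly_Mapping.keys u \<subseteq> A"
  shows "push f u = (\<Sum>x\<in>A. Poly_Mapping.single (f x) (Poly_Mapping.lookup u x))"
  unfolding push_def
  by (rule sum.mono_neutral_left) (use assms in \<open>auto simp: in_keys_iff\<close>)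

lemma push_zero [simp]: "push f 0 = 0"
  by (simp add: push_def)

lemma push_single [simp]: "push f (Poly_Mapping.single x c) = Poly_Mapping.single (f x) c"
  by (cases "c = 0") (simp_all add: push_def)

lemma push_add: "push f (u + v) = push f u + push f v"
proof -
  let ?A = "Poly_Mapping.keys u \<union> Poly_Mapping.keys v"
  have "Poly_Mapping.keys (u + v) \<subseteq> ?A"
    by (rule keys_add)
  then show ?thesis
    by (simp add: push_superset[of ?A] lookup_add single_add sum.distrib)
qed

lemma push_sum: "push f (sum u A) = (\<Sum>i\<in>A. push f (u i))"
  by (induction A rule: infinite_finite_induct) (simp_all add: push_add)

lemma push_push: "push g (push f u) = push (\<lambda>x. g (f x)) u"
  by (simp add: push_def[of f] push_def[of "\<lambda>x. g (f x)"] push_sum)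

lemma push_cong:
  "(\<And>x. x \<in> Poly_Mapping.keys u \<Longrightarrow> f x = g x) \<Longrightarrow> push f u = push g u"
  by (simp add: push_def)

lemma push_ident: "push (\<lambda>x. x) u = u"
  by (rule poly_mapping_eqI) (simp add: push_def lookup_sum lookup_single when_def in_keys_iff)

lemma push_inverse:
  "(\<And>x. x \<in> Poly_Mapping.keys u \<Longrightarrow> g (f x) = x) \<Longrightarrow> push g (push f u) = u"
  by (metis (mono_tags, lifting) push_push push_cong push_ident)

lemma keys_push: "Poly_Mapping.keys (push f u) \<subseteq> f ` Poly_Mapping.keys u"
proof -
  have "Poly_Mapping.keys (push f u)
      \<subseteq> (\<Union>x\<in>Poly_Mapping.keys u.
            Poly_Mapping.keys (Poly_Mapping.single (f x) (Poly_Mapping.lookup u x)))"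
    unfolding push_def by (rule keys_sum)
  then show ?thesis
    by (auto split: if_splits)
qed

lemma push_in_qring: "f ` X \<subseteq> Y \<Longrightarrow> u \<in> qring X \<Longrightarrow> push f u \<in> qring Y"
  using keys_push[of f u] by (fastforce simp: qring_def)

text \<open>Supports lie in \<open>X\<close> and \<open>Y\<close>, so it is enough that
  \<open>inv_into X f\<close> inverts \<open>f\<close> on these sets.\<close>

lemma bij_betw_push:
  assumes "bij_betw f X Y"
  shows "bij_betw (push f) (qring X) (qring Y :: ('b \<Rightarrow>\<^sub>0 'k::comm_ring_1) set)"
proof (rule bij_betw_byWitness[where f' = "push (inv_into X f)"])
  show "\<forall>u\<in>qring X. push (inv_into X f) (push f u) = u"
    using assms by (auto simp: qring_def bij_betw_def intro!: push_inverse)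
  show "\<forall>u\<in>qring Y. push f (push (inv_into X f) u) = u"
    using assms
    by (auto simp: qring_def bij_betw_def f_inv_into_f subset_iff intro!: push_inverse)
  show "push f ` qring X \<subseteq> qring Y"
    using assms push_in_qring[of f X Y] by (auto simp: bij_betw_def)
  show "push (inv_into X f) ` qring Y \<subseteq> qring X"
    using bij_betw_inv_into[OF assms] push_in_qring[of "inv_into X f" Y X]
    by (auto simp: bij_betw_def)
qed

section \<open>The product of a quandle ring\<close>

lemma qmult_superset:
  assumes "finite A" "Poly_Mapping.keys u \<subseteq> A" "finite B" "Poly_Mapping.keys v \<subseteq> B"
  shows "qmult m u v = (\<Sum>x\<in>A. \<Sum>y\<in>B.
           Poly_Mapping.single (m x y) (Poly_Mapping.lookup u x * Poly_Mapping.lookup v y))"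
proof -
  have "qmult m u v = (\<Sum>x\<in>Poly_Mapping.keys u. \<Sum>y\<in>B.
           Poly_Mapping.single (m x y) (Poly_Mapping.lookup u x * Poly_Mapping.lookup v y))"
    unfolding qmult_def
    by (intro sum.cong sum.mono_neutral_left refl) (use assms in \<open>auto simp: in_keys_iff\<close>)
  also have "\<dots> = (\<Sum>x\<in>A. \<Sum>y\<in>B.
           Poly_Mapping.single (m x y) (Poly_Mapping.lookup u x * Poly_Mapping.lookup v y))"
    by (rule sum.mono_neutral_left) (use assms in \<open>auto simp: in_keys_iff\<close>)
  finally show ?thesis .
qed

lemma qmult_zero_left [simp]: "qmult m 0 v = 0"
  and qmult_zero_right [simp]: "qmult m u 0 = 0"
  by (simp_all add: qmult_def)

lemma qmult_single_single:
  "qmult m (Poly_Mapping.single x a) (Poly_Mapping.single y b)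
     = Poly_Mapping.single (m x y) (a * b)"
  by (subst qmult_superset[of "{x}" _ "{y}"]) auto

lemma qmult_add_left: "qmult m (u + u') v = qmult m u v + qmult m u' v"
proof -
  let ?A = "Poly_Mapping.keys u \<union> Poly_Mapping.keys u'"
  have "Poly_Mapping.keys (u + u') \<subseteq> ?A"
    by (rule keys_add)
  then show ?thesis
    by (simp add: qmult_superset[of ?A _ "Poly_Mapping.keys v"] lookup_add distrib_right
        single_add sum.distrib)
qed

lemma qmult_add_right: "qmult m u (v + v') = qmult m u v + qmult m u v'"
proof -
  let ?B = "Poly_Mapping.keys v \<union> Poly_Mapping.keys v'"
  have "Poly_Mapping.keys (v + v') \<subseteq> ?B"
    by (rule keys_add)
  then show ?thesis
    by (simp add: qmult_superset[of "Poly_Mapping.keys u" _ ?B] lookup_add distrib_left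
        single_add sum.distrib)
qed

lemma qmult_sum_left: "qmult m (sum u A) v = (\<Sum>i\<in>A. qmult m (u i) v)"
  by (induction A rule: infinite_finite_induct) (simp_all add: qmult_add_left)

lemma qmult_sum_right: "qmult m u (sum v A) = (\<Sum>i\<in>A. qmult m u (v i))"
  by (induction A rule: infinite_finite_induct) (simp_all add: qmult_add_right)

text \<open>By bilinearity the product can be expanded over the supports of \<open>u\<close> and
  \<open>v\<close> themselves, which avoids the supports of the pushforwards, where terms may merge
  or cancel.\<close>

lemma qmult_push_push:
  "qmult m (push f u) (push g v) = (\<Sum>x\<in>Poly_Mapping.keys u. \<Sum>y\<in>Poly_Mapping.keys v.
     Poly_Mapping.single (m (f x) (g y)) (Poly_Mapping.lookup u x * Poly_Mapping.lookup v y))"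
  \<comment> \<open>Expanding the left factor first makes the sum over \<open>u\<close> the outer
    one.\<close>
  unfolding push_def qmult_sum_left unfolding qmult_sum_right qmult_single_single ..

text \<open>Both sides expand to sums over pairs of basis elements, and on such pairs the claim is
  the homomorphism property of \<open>f\<close>.\<close>

lemma push_qmult:
  assumes "magma_hom X m Y n f" "u \<in> qring X" "v \<in> qring X"
  shows "push f (qmult m u v) = qmult n (push f u) (push f v)"
  unfolding qmult_push_push unfolding qmult_def push_sum push_single
  using assms by (intro sum.cong refl) (auto simp: magma_hom_def qring_def subset_iff)

text \<open>The two expansions agree term by term. With \<open>s\<close> moving points inside the
  fibres of a covering, this is how the covering condition enters the ring.\<close>

lemma qmult_push_right:
  assumes "\<And>z x. z \<in> Poly_Mapping.keys w \<Longrightarrow> x \<in> Poly_Mapping.keys u \<Longrightarrow> m z (s x) = m z x"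
  shows "qmult m w (push s u) = qmult m w u"
proof -
  \<comment> \<open>Writing \<open>w\<close> as a pushforward along the identity makes
    \<open>qmult_push_push\<close> applicable.\<close>
  have "qmult m w (push s u) = qmult m (push (\<lambda>z. z) w) (push s u)"
    by (simp add: push_ident)
  also have "\<dots> = qmult m w u"
    unfolding qmult_push_push unfolding qmult_def using assms by (intro sum.cong refl) auto
  finally show ?thesis .
qed

lemma qmult_in_qring:
  assumes "\<And>x y. x \<in> X \<Longrightarrow> y \<in> X \<Longrightarrow> m x y \<in> X" "u \<in> qring X" "v \<in> qring X"
  shows "qmult m u v \<in> qring X"
proof -
  have "Poly_Mapping.lookup (qmult m u v) z = 0" if "z \<notin> X" for z
    using assms that
    by (auto simp: qmult_def lookup_sum lookup_single qring_def when_def subset_iff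
        intro!: sum.neutral)
  then show ?thesis
    by (auto simp: qring_def in_keys_iff)
qed

lemma qmult_basis_elt_right: "qmult m w (basis_elt x) = push (\<lambda>z. m z x) w"
  by (subst qmult_superset[of "Poly_Mapping.keys w" _ "{x}"])
    (auto simp: basis_elt_def push_def)

text \<open>Right multiplication by \<open>basis_elt x\<close> is the linear extension of the
  translation by \<open>x\<close>, so bijectivity and multiplicativity are inherited from that
  translation.\<close>

lemma qring_aut_right_mult:
  assumes "magma_aut X m (\<lambda>z. m z x)"
  shows "qring_aut X m (\<lambda>w :: 'a \<Rightarrow>\<^sub>0 'k::comm_ring_1. qmult m w (basis_elt x))"
  using assms unfolding qring_aut_def magma_aut_def qmult_basis_elt_right
  by (auto simp: bij_betw_push push_add intro: push_qmult)

section \<open>Idempotents\<close>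

lemma basis_elt_idempotent:
  assumes "quandle X m" "x \<in> X"
  shows "(basis_elt x :: 'a \<Rightarrow>\<^sub>0 'k::idom) \<in> idempotents X m"
proof -
  have "Poly_Mapping.lookup (basis_elt x :: 'a \<Rightarrow>\<^sub>0 'k) x \<noteq> 0"
    by (simp add: basis_elt_def)
  then have "(basis_elt x :: 'a \<Rightarrow>\<^sub>0 'k) \<noteq> 0"
    by auto
  then show ?thesis
    using assms quandle.idem[OF assms]
    by (auto simp: idempotents_def qring_def qmult_basis_elt) (simp add: basis_elt_def)
qed

text \<open>Being a non-zero solution of \<open>u u = u\<close> is both preserved and reflected by
  an injective ring homomorphism; reflection gives surjectivity on the idempotents.\<close>

lemma magma_aut_idempotents:
  fixes f :: "('a \<Rightarrow>\<^sub>0 'k::comm_ring_1) \<Rightarrow> ('a \<Rightarrow>\<^sub>0 'k)"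
  assumes "qring_aut X m f" and closed: "\<And>x y. x \<in> X \<Longrightarrow> y \<in> X \<Longrightarrow> m x y \<in> X"
  shows "magma_aut (idempotents X m) (qmult m) f"
proof -
  have bij: "bij_betw f (qring X) (qring X)"
    and add: "\<And>u v. u \<in> qring X \<Longrightarrow> v \<in> qring X \<Longrightarrow> f (u + v) = f u + f v"
    and mult: "\<And>u v. u \<in> qring X \<Longrightarrow> v \<in> qring X \<Longrightarrow> f (qmult m u v) = qmult m (f u) (f v)"
    using assms by (auto simp: qring_aut_def)
  have inj: "inj_on f (qring X)" and img: "f ` qring X = qring X"
    using bij by (auto simp: bij_betw_def)
  have zero_in: "0 \<in> qring X"
    by (simp add: qring_def)
  have "f 0 = 0"
    using add[OF zero_in zero_in] by simp
  then have nonzero: "f u \<noteq> 0 \<longleftrightarrow> u \<noteq> 0" if "u \<in> qring X" for u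
    using inj_onD[OF inj _ that zero_in] by auto
  have idem_iff: "f u \<in> idempotents X m \<longleftrightarrow> u \<in> idempotents X m" if u: "u \<in> qring X" for u
  proof -
    \<comment> \<open>Injectivity of \<open>f\<close> is known only on \<open>qring X\<close>, so
      the square has to lie there before \<open>f\<close> can be cancelled.\<close>
    have "qmult m u u \<in> qring X"
      using closed u u by (rule qmult_in_qring)
    then have "f (qmult m u u) = f u \<longleftrightarrow> qmult m u u = u"
      using inj_onD[OF inj _ _ u] by auto
    then show ?thesis
      using u img nonzero[OF u] by (auto simp: idempotents_def mult)
  qed
  have sub: "(idempotents X m :: ('a \<Rightarrow>\<^sub>0 'k) set) \<subseteq> qring X"
    by (auto simp: idempotents_def)
  have "f ` idempotents X m = idempotents X m"
  proof
    show "f ` idempotents X m \<subseteq> idempotents X m"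
      using idem_iff sub by auto
    show "(idempotents X m :: ('a \<Rightarrow>\<^sub>0 'k) set) \<subseteq> f ` idempotents X m"
    proof
      fix v :: "'a \<Rightarrow>\<^sub>0 'k" assume v: "v \<in> idempotents X m"
      then have "v \<in> f ` qring X"
        using sub img by auto
      then obtain u where "u \<in> qring X" "v = f u" ..
      then show "v \<in> f ` idempotents X m"
        using v idem_iff by auto
    qed
  qed
  moreover have "f (qmult m u v) = qmult m (f u) (f v)"
    if "u \<in> idempotents X m" "v \<in> idempotents X m" for u v
    using that sub by (intro mult) auto
  ultimately show ?thesis
    using inj_on_subset[OF inj sub] by (auto simp: magma_aut_def magma_hom_def bij_betw_def)
qed

text \<open>Closure matters because the homomorphism law evaluates \<open>g\<close> at products,
  where agreement with \<open>f\<close> is known only inside \<open>X\<close>.\<close>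

lemma magma_aut_cong:
  assumes f: "magma_aut X m f" and eq: "\<And>x. x \<in> X \<Longrightarrow> g x = f x"
    and closed: "\<And>x y. x \<in> X \<Longrightarrow> y \<in> X \<Longrightarrow> m x y \<in> X"
  shows "magma_aut X m g"
  using assms bij_betw_cong[of X g f X]
  by (auto simp: magma_aut_def magma_hom_def bij_betw_def)

text \<open>On the idempotents, right multiplication by \<open>u\<close> coincides with that by some
  \<open>basis_elt x\<close>, which restricts to an automorphism there.\<close>

lemma quandle_idempotents:
  fixes X :: "'a set"
  assumes X: "quandle X m"
    and right: "\<And>u :: 'a \<Rightarrow>\<^sub>0 'k::idom. u \<in> idempotents X m \<Longrightarrow>
      \<exists>x\<in>X. \<forall>w\<in>qring X. qmult m w u = qmult m w (basis_elt x)"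
  shows "quandle (idempotents X m :: ('a \<Rightarrow>\<^sub>0 'k) set) (qmult m)"
proof
  interpret X: quandle X m by (rule X)
  show "(idempotents X m :: ('a \<Rightarrow>\<^sub>0 'k) set) \<noteq> {}"
    using basis_elt_idempotent[OF X] X.nonempty by blast
  fix u :: "'a \<Rightarrow>\<^sub>0 'k" assume u: "u \<in> idempotents X m"
  then show "qmult m u u = u"
    by (simp add: idempotents_def)
  obtain x where x: "x \<in> X" and eq: "\<And>w. w \<in> qring X \<Longrightarrow> qmult m w u = qmult m w (basis_elt x)"
    using right[OF u] by blast
  have cl: "m x y \<in> X" if "x \<in> X" "y \<in> X" for x y
    using X.right_aut[OF that(2)] that(1) by (auto simp: magma_aut_def bij_betw_def)
  have aut: "magma_aut (idempotents X m) (qmult m) (\<lambda>w :: 'a \<Rightarrow>\<^sub>0 'k. qmult m w (basis_elt x))"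
    if "x \<in> X" for x
    using qring_aut_right_mult[OF X.right_aut[OF that]] cl by (rule magma_aut_idempotents)
  note aut[OF x]
  moreover have "qmult m w u = qmult m w (basis_elt x)" if "w \<in> idempotents X m" for w
    using that eq by (simp add: idempotents_def)
  \<comment> \<open>The product \<open>v w\<close> equals \<open>v\<close> times a basis element,
    hence is the image of \<open>v\<close> under one of these automorphisms.\<close>
  moreover have "qmult m v w \<in> idempotents X m"
    if v: "v \<in> idempotents X m" and w: "w \<in> idempotents X m" for v w :: "'a \<Rightarrow>\<^sub>0 'k"
  proof -
    obtain z where z: "z \<in> X" and eqz: "\<And>w'. w' \<in> qring X \<Longrightarrow> qmult m w' w = qmult m w' (basis_elt z)"
      using right[OF w] by blast
    have "qmult m v (basis_elt z) \<in> idempotents X m"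
      using aut[OF z] v by (auto simp: magma_aut_def bij_betw_def)
    then show ?thesis
      using v eqz by (simp add: idempotents_def)
  qed
  ultimately show "magma_aut (idempotents X m) (qmult m) (\<lambda>w. qmult m w u)"
    by (rule magma_aut_cong)
qed

lemma right_mult_idempotent_covering:
  fixes u :: "'a \<Rightarrow>\<^sub>0 'k::comm_ring_1"
  assumes cov: "quandle_covering X m Y n p"
    and triv: "(idempotents Y n :: ('b \<Rightarrow>\<^sub>0 'k) set) \<subseteq> trivial_idempotents Y"
    and u: "u \<in> idempotents X m"
  shows "\<exists>x\<in>X. \<forall>w\<in>qring X. qmult m w u = qmult m w (basis_elt x)"
proof -
  have hom: "magma_hom X m Y n p" and surj: "p ` X = Y"
    and fibre: "\<And>x x' z. x \<in> X \<Longrightarrow> x' \<in> X \<Longrightarrow> z \<in> X \<Longrightarrow> p x = p x' \<Longrightarrow> m z x = m z x'"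
    using cov unfolding quandle_covering_def by blast+
  have uX: "u \<in> qring X" and "u \<noteq> 0" and uu: "qmult m u u = u"
    using u by (auto simp: idempotents_def)
  \<comment> \<open>A section of \<open>p\<close>: it picks one point in each fibre, so
    \<open>push s\<close> lifts elements of \<open>k[Y]\<close> back to \<open>k[X]\<close>.\<close>
  define s where "s = inv_into X p"
  have factor: "qmult m w u = qmult m w (push s (push p u))" if "w \<in> qring X" for w
  proof -
    \<comment> \<open>The points \<open>s (p x)\<close> and \<open>x\<close> lie in the same fibre
      of \<open>p\<close>.\<close>
    have "m z (s (p x)) = m z x" if "z \<in> X" "x \<in> X" for z x
      unfolding s_def using that by (intro fibre inv_into_into f_inv_into_f imageI)
    then show ?thesis
      using that uX unfolding push_push
      by (intro qmult_push_right[symmetric]) (auto simp: qring_def)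
  qed
  have "push p u \<noteq> 0"
    using factor[OF uX] uu \<open>u \<noteq> 0\<close> by auto
  moreover have "push p u \<in> qring Y"
    using surj uX by (intro push_in_qring[of p X]) auto
  moreover have "qmult n (push p u) (push p u) = push p u"
    using push_qmult[OF hom uX uX] uu by simp
  ultimately obtain y where "y \<in> Y" and y: "push p u = basis_elt y"
    using triv by (auto simp: idempotents_def trivial_idempotents_def)
  have "s y \<in> X"
    unfolding s_def using \<open>y \<in> Y\<close> surj by (metis inv_into_into)
  \<comment> \<open>The lift of \<open>basis_elt y\<close> is \<open>basis_elt (s y)\<close>, so the
    chosen point over \<open>y\<close> is the witness.\<close>
  moreover have "qmult m w u = qmult m w (basis_elt (s y))" if "w \<in> qring X" for w
    using factor[OF that] y by (simp add: basis_elt_def)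
  ultimately show ?thesis
    by blast
qed

theorem corollary4p12:
  fixes X :: "'a set" and m :: "'a \<Rightarrow> 'a \<Rightarrow> 'a"
    and Y :: "'b set" and n :: "'b \<Rightarrow> 'b \<Rightarrow> 'b"
    and p :: "'a \<Rightarrow> 'b"
  assumes "finite (UNIV :: 'k::idom set) \<longrightarrow> 2 < card (UNIV :: 'k set)"
    and "quandle X m" and "finite_type X m"
    and "finite X \<longrightarrow> \<not> ((of_nat (card X) :: 'k) dvd 1)"
    and "quandle Y n"
    and "quandle_covering X m Y n p"
    and "(idempotents Y n :: ('b \<Rightarrow>\<^sub>0 'k) set) \<subseteq> trivial_idempotents Y"
  shows "quandle (idempotents X m :: ('a \<Rightarrow>\<^sub>0 'k) set) (qmult m)
    \<and> (\<forall>u \<in> (idempotents X m :: ('a \<Rightarrow>\<^sub>0 'k) set). \<exists>x\<in>X.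
         (\<forall>w\<in>qring X. qmult m w u = qmult m w (basis_elt x)) \<and>
         qring_aut X m (\<lambda>w :: 'a \<Rightarrow>\<^sub>0 'k. qmult m w (basis_elt x)))"
proof (intro conjI ballI)
  note right = right_mult_idempotent_covering[OF assms(6,7)]
  show "quandle (idempotents X m :: ('a \<Rightarrow>\<^sub>0 'k) set) (qmult m)"
    using assms(2) right by (rule quandle_idempotents)
  fix u :: "'a \<Rightarrow>\<^sub>0 'k" assume "u \<in> idempotents X m"
  from right[OF this] obtain x
    where "x \<in> X" "\<forall>w\<in>qring X. qmult m w u = qmult m w (basis_elt x)" ..
  then show "\<exists>x\<in>X. (\<forall>w\<in>qring X. qmult m w u = qmult m w (basis_elt x)) \<and>
      qring_aut X m (\<lambda>w :: 'a \<Rightarrow>\<^sub>0 'k. qmult m w (basis_elt x))"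
    using qring_aut_right_mult[OF quandle.right_aut[OF assms(2)]] by blast
qed

end
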